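(* Let $E$ and $F$ be Archimedean Riesz spaces. If $T:E\to F$ is a lattice homomorphism such that $T(\lambda x)=\lambda T(x)$ for each $\lambda\in\mathbb{R}$ and each $x\in E$, then $T$ is linear (that is, $T$ is a Riesz homomorphism).
   Context: A map $T:E\to F$ between Riesz spaces (real vector lattices), not assumed linear, is called a lattice homomorphism if $T(x\vee y)=Tx\vee Ty$ and $T(x\wedge y)=Tx\wedge Ty$ for all $x,y\in E$. A linear lattice homomorphism is called a Riesz homomorphism. *)

theory Defs
  imports Complex_Main
begin

class riesz_space = ordered_real_vector + lattice

text \<open>The additional axiom says that \<open>x / n\<close> (for \<open>n = 1, 2, \<dots>\<close>) has infimum \<open>0\<close> for every
  \<open>x \<ge> 0\<close>; that \<open>0\<close> is a lower bound holds in any ordered real vector space.\<close>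

class archimedean_riesz_space = riesz_space +
  assumes archimedean:
    "0 \<le> x \<Longrightarrow> (\<And>n::nat. n \<ge> 1 \<Longrightarrow> y \<le> (1 / real n) *\<^sub>R x) \<Longrightarrow> y \<le> 0"

definition lattice_homomorphism :: "('a::riesz_space \<Rightarrow> 'b::riesz_space) \<Rightarrow> bool" where
  "lattice_homomorphism T \<longleftrightarrow>
     (\<forall>x y. T (sup x y) = sup (T x) (T y)) \<and> (\<forall>x y. T (inf x y) = inf (T x) (T y))"

definition riesz_homomorphism :: "('a::riesz_space \<Rightarrow> 'b::riesz_space) \<Rightarrow> bool" where
  "riesz_homomorphism T \<longleftrightarrow> linear T \<and> lattice_homomorphism T"

end

theory Submission
  imports Defs "HOL-Library.Lattice_Algebras"
begin

text \<open>For \<open>x, y \<ge> 0\<close> put \<open>e = x + y\<close> and \<open>u = T e\<close>. The elements \<open>p c = T ((x - c e)\<^sup>+)\<close> and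
  \<open>n c = T ((c e - x)\<^sup>+)\<close> are disjoint. Sandwiching \<open>x\<close> and \<open>y\<close> between lattice expressions in
  \<open>e\<close>, \<open>(x - c e)\<^sup>+\<close> and \<open>(c e - x)\<^sup>+\<close> (multiplied by scalars) shows that, up to a multiple of
  \<open>p (c + \<delta>) + n c\<close>, \<open>T x\<close> is within \<open>2 \<delta> u\<close> of \<open>c u\<close> and \<open>T y\<close> is within \<open>2 \<delta> u\<close> of
  \<open>(1 - c) u\<close>. Running through the grid \<open>c = j \<delta>\<close>, the disjointness of \<open>p c\<close> and \<open>n c\<close> removes
  the error terms, so that \<open>T x + T y\<close> is within \<open>3 \<delta> u\<close> of \<open>u\<close>; as \<open>F\<close> is Archimedean, they are
  equal. Additivity on the positive cone extends to \<open>E\<close> by decomposing into positive and negative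
  parts.\<close>

\<comment> \<open>Disjointness and positive parts in Riesz spaces\<close>
subclass (in riesz_space) lattice_ab_group_add ..

text \<open>Dividing the infimum by \<open>max 1 k\<close> gives \<open>m\<close> below both
  \<open>a\<close> and \<open>b + c\<close>. Then \<open>m - b\<close> lies below \<open>a\<close>
  and \<open>c\<close>, so \<open>m \<le> b\<close>, and \<open>inf a b = 0\<close> forces
  \<open>m \<le> 0\<close>.\<close>

lemma disjoint_scaleR_add:
  fixes a b c :: "'a::riesz_space"
  assumes "0 \<le> a" "0 \<le> b" "0 \<le> c" "0 \<le> k" "inf a b = 0" "inf a c = 0"
  shows "inf a (k *\<^sub>R (b + c)) = 0"
proof -
  define K where "K = max 1 k"
  have K: "K \<ge> 1" "K \<ge> k" by (auto simp: K_def)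
  define m where "m = (1 / K) *\<^sub>R inf a (k *\<^sub>R (b + c))"
  have bc: "0 \<le> b + c" using assms by simp
  have nn: "0 \<le> inf a (k *\<^sub>R (b + c))"
    using assms bc by (simp add: scaleR_nonneg_nonneg)
  have "m \<le> 1 *\<^sub>R inf a (k *\<^sub>R (b + c))"
    unfolding m_def using K nn by (intro scaleR_right_mono) auto
  also have "\<dots> \<le> a" by simp
  finally have ma: "m \<le> a" .
  have "m \<le> (1 / K) *\<^sub>R (k *\<^sub>R (b + c))"
    unfolding m_def using K by (intro scaleR_left_mono) auto
  also have "\<dots> = (k / K) *\<^sub>R (b + c)" by simp
  also have "\<dots> \<le> 1 *\<^sub>R (b + c)"
    using K bc by (intro scaleR_right_mono) auto
  finally have "m \<le> b + c" by simp
  then have "m - b \<le> c" by (simp add: algebra_simps)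
  moreover have "m - b \<le> a" using ma assms(2) by (simp add: diff_le_eq add_increasing2)
  ultimately have "m - b \<le> inf a c" by simp
  then have "m \<le> b" using assms by simp
  with ma have "m \<le> inf a b" by simp
  then have "m \<le> 0" using assms by simp
  then have "K *\<^sub>R m \<le> K *\<^sub>R 0" using K by (intro scaleR_left_mono) auto
  then have "inf a (k *\<^sub>R (b + c)) \<le> 0" using K by (simp add: m_def)
  then show ?thesis using nn by (rule antisym)
qed

text \<open>Disjointness of \<open>v\<close> from \<open>n j\<close> propagates along the chain:
  \<open>inf v (n (Suc j))\<close> is disjoint from \<open>n j\<close> by induction and from
  \<open>p (Suc j)\<close> by assumption, yet lies below a multiple of their sum. At the end
  \<open>v\<close> is below a multiple of an element disjoint from it.\<close>

lemma disjoint_chain_eq_zero: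
  fixes p n :: "nat \<Rightarrow> 'a::riesz_space"
  assumes "\<And>j. 0 \<le> p j" "\<And>j. 0 \<le> n j" "\<And>j. inf (n j) (p j) = 0" "n 0 = 0"
    and "0 \<le> v" "0 \<le> K" "0 \<le> L"
    and v: "\<And>j. j \<le> N \<Longrightarrow> v \<le> K *\<^sub>R (p (Suc j) + n j)" "v \<le> L *\<^sub>R n (Suc N)"
  shows "v = 0"
proof -
  have "j \<le> Suc N \<Longrightarrow> inf v (n j) = 0" for j
  proof (induction j)
    case 0
    then show ?case using assms by (simp add: inf_absorb2)
  next
    case (Suc j)
    define d where "d = inf v (n (Suc j))"
    have d0: "0 \<le> d" using assms by (simp add: d_def)
    have "inf d (n j) = inf (inf v (n j)) (n (Suc j))" by (simp add: d_def ac_simps)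
    then have dn: "inf d (n j) = 0" using Suc assms by (simp add: inf_absorb1)
    have "inf d (p (Suc j)) = inf v (inf (n (Suc j)) (p (Suc j)))" by (simp add: d_def ac_simps)
    then have dp: "inf d (p (Suc j)) = 0" using assms by (simp add: inf_absorb2)
    have "inf d (K *\<^sub>R (p (Suc j) + n j)) = 0"
      by (intro disjoint_scaleR_add d0 dn dp assms)
    moreover have "d \<le> K *\<^sub>R (p (Suc j) + n j)"
      unfolding d_def using v(1)[of j] Suc.prems by (simp add: le_infI1)
    ultimately show ?case by (simp add: inf_absorb1 d_def)
  qed
  then have "inf v (L *\<^sub>R (n (Suc N) + 0)) = 0"
    using assms by (intro disjoint_scaleR_add) (auto simp: inf_absorb2)
  with v(2) show ?thesis by (simp add: inf_absorb1)
qed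

text \<open>This stands in for the missing additivity: a convex combination is replaced by a
  supremum, through which a lattice homomorphism can pass.\<close>

lemma convex_le_sup:
  fixes a b :: "'a::riesz_space"
  assumes "0 \<le> s" "0 \<le> t" "s + t = 1"
  shows "s *\<^sub>R a + t *\<^sub>R b \<le> sup a b"
proof -
  have "s *\<^sub>R a + t *\<^sub>R b \<le> s *\<^sub>R sup a b + t *\<^sub>R sup a b"
    using assms by (intro add_mono scaleR_left_mono) auto
  also have "\<dots> = sup a b" using assms by (simp flip: scaleR_add_left)
  finally show ?thesis .
qed

lemma sup_le_add:
  fixes a b :: "'a::riesz_space"
  assumes "0 \<le> a" "0 \<le> b"
  shows "sup a b \<le> a + b"
  using assms by (simp add: add_increasing add_increasing2)

lemma inf_pos_neg_part:
  fixes a :: "'a::riesz_space"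
  shows "inf (sup a 0) (sup (- a) 0) = 0"
proof -
  have "sup (- a) 0 = 0 - inf a 0" by (simp add: neg_inf_eq_sup)
  moreover have "sup a 0 = a - inf a 0"
    using prts[of a, symmetric] unfolding pprt_def nprt_def eq_diff_eq .
  moreover have "inf (a - inf a 0) (0 - inf a 0) = inf a 0 - inf a 0"
    using add_inf_distrib_right[of a 0 "- inf a 0"] by (simp only: diff_conv_add_uminus)
  ultimately show ?thesis by (simp only: diff_self)
qed

lemma eq_pos_part_diff_neg_part:
  fixes z :: "'a::riesz_space"
  shows "z = sup z 0 - sup (- z) 0"
  using prts[of z] neg_inf_eq_sup[of z 0] by (simp add: pprt_def nprt_def)

section \<open>One-sided estimates from homogeneity\<close>

locale homogeneous_lattice_homomorphism =
  fixes T :: "'a::riesz_space \<Rightarrow> 'b::riesz_space"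
  assumes hom: "lattice_homomorphism T"
    and scale: "T (c *\<^sub>R x) = c *\<^sub>R T x"
begin

lemma T_sup: "T (sup x y) = sup (T x) (T y)"
  and T_inf: "T (inf x y) = inf (T x) (T y)"
  using hom by (auto simp: lattice_homomorphism_def)

lemma T_zero: "T 0 = 0"
  using scale[of 0 0] by simp

lemma T_minus: "T (- x) = - T x"
  using scale[of "-1" x] by simp

lemma T_mono: "x \<le> y \<Longrightarrow> T x \<le> T y"
  by (metis T_sup sup.absorb_iff2 sup_ge1)

lemma T_nonneg: "0 \<le> x \<Longrightarrow> 0 \<le> T x"
  using T_mono[of 0 x] by (simp add: T_zero)

text \<open>With weights \<open>c / (c + d)\<close> and \<open>d / (c + d)\<close>, \<open>x\<close>
  is a convex combination of \<open>(c + d) *\<^sub>R e\<close> and a multiple of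
  \<open>x - c *\<^sub>R e\<close>, hence below their supremum.\<close>

lemma T_upper:
  assumes "0 \<le> e" "0 \<le> c" "0 < d"
  shows "T x \<le> (c + d) *\<^sub>R T e + ((c + d) / d) *\<^sub>R T (sup (x - c *\<^sub>R e) 0)"
proof -
  let ?p = "sup (x - c *\<^sub>R e) 0" and ?k = "(c + d) / d"
  have "c / (c + d) * (c + d) = c" "d / (c + d) * ?k = 1"
    using assms by auto
  then have "x = (c / (c + d)) *\<^sub>R ((c + d) *\<^sub>R e) + (d / (c + d)) *\<^sub>R (?k *\<^sub>R (x - c *\<^sub>R e))"
    unfolding scaleR_scaleR by simp
  also have "\<dots> \<le> sup ((c + d) *\<^sub>R e) (?k *\<^sub>R (x - c *\<^sub>R e))"
    using assms by (intro convex_le_sup) (auto simp: add_divide_distrib[symmetric])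
  also have "\<dots> \<le> sup ((c + d) *\<^sub>R e) (?k *\<^sub>R ?p)"
    using assms by (intro sup_mono scaleR_left_mono) auto
  finally have "T x \<le> sup ((c + d) *\<^sub>R T e) (?k *\<^sub>R T ?p)"
    using T_mono T_sup scale by metis
  also have "\<dots> \<le> (c + d) *\<^sub>R T e + ?k *\<^sub>R T ?p"
    using assms by (intro sup_le_add scaleR_nonneg_nonneg T_nonneg) auto
  finally show ?thesis .
qed

text \<open>In the convex combination of \<open>x\<close> and
  \<open>(1 / d) *\<^sub>R (c *\<^sub>R e - x)\<close> with weights \<open>1 / (1 + d)\<close> and
  \<open>d / (1 + d)\<close>, the element \<open>x\<close> cancels.\<close>

lemma T_lower:
  assumes "0 \<le> x" "0 < d"
  shows "(c / (1 + d)) *\<^sub>R T e \<le> T x + (1 / d) *\<^sub>R T (sup (c *\<^sub>R e - x) 0)"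
proof -
  let ?n = "sup (c *\<^sub>R e - x) 0"
  have "(c / (1 + d)) *\<^sub>R e = (1 / (1 + d)) *\<^sub>R x + (d / (1 + d)) *\<^sub>R ((1 / d) *\<^sub>R (c *\<^sub>R e - x))"
    using assms by (simp add: algebra_simps)
  also have "\<dots> \<le> sup x ((1 / d) *\<^sub>R (c *\<^sub>R e - x))"
    using assms by (intro convex_le_sup) (auto simp: add_divide_distrib[symmetric])
  also have "\<dots> \<le> sup x ((1 / d) *\<^sub>R ?n)"
    using assms by (intro sup_mono scaleR_left_mono) auto
  finally have "(c / (1 + d)) *\<^sub>R T e \<le> sup (T x) ((1 / d) *\<^sub>R T ?n)"
    using T_mono T_sup scale by metis
  also have "\<dots> \<le> T x + (1 / d) *\<^sub>R T ?n"
    using assms by (intro sup_le_add scaleR_nonneg_nonneg T_nonneg) auto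
  finally show ?thesis .
qed

section \<open>Estimates along a grid and removal of the error terms\<close>

lemma T_upper_grid:
  assumes "0 \<le> e" "0 \<le> c" "0 < d" "(c + d) / d \<le> K" "T (sup (x - c *\<^sub>R e) 0) \<le> q" "c + d \<le> b"
  shows "T x \<le> b *\<^sub>R T e + K *\<^sub>R q"
proof -
  have "0 \<le> T (sup (x - c *\<^sub>R e) 0)" "0 \<le> T e"
    using assms by (auto intro: T_nonneg)
  moreover have "0 \<le> (c + d) / d" using assms by simp
  moreover have "0 \<le> K" using \<open>0 \<le> (c + d) / d\<close> assms(4) by linarith
  ultimately have "(c + d) *\<^sub>R T e + ((c + d) / d) *\<^sub>R T (sup (x - c *\<^sub>R e) 0) \<le> b *\<^sub>R T e + K *\<^sub>R q"
    using assms by (intro add_mono scaleR_mono scaleR_right_mono) auto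
  with T_upper[OF assms(1-3)] show ?thesis by (rule order_trans)
qed

lemma T_lower_grid:
  assumes "0 \<le> e" "0 \<le> x" "0 < d" "1 / d \<le> K" "T (sup (c *\<^sub>R e - x) 0) \<le> q" "c \<le> 1 + d" "b \<le> c - d"
  shows "b *\<^sub>R T e \<le> T x + K *\<^sub>R q"
proof -
  \<comment> \<open>This trades the factor \<open>c / (1 + d)\<close> for \<open>c - d\<close>, so
    that coefficients at a grid point add up exactly.\<close>
  have "d * c \<le> d * (1 + d)" using assms by (intro mult_left_mono) auto
  then have "(c - d) * (1 + d) \<le> c" by (simp add: algebra_simps)
  then have "c - d \<le> c / (1 + d)" using assms by (simp add: pos_le_divide_eq)
  then have "b *\<^sub>R T e \<le> (c / (1 + d)) *\<^sub>R T e"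
    using assms by (intro scaleR_right_mono T_nonneg) auto
  also have "\<dots> \<le> T x + (1 / d) *\<^sub>R T (sup (c *\<^sub>R e - x) 0)"
    using assms by (intro T_lower)
  also have "\<dots> \<le> T x + K *\<^sub>R q"
    using assms order_trans[of 0 "1 / d" K] by (intro add_mono scaleR_mono T_nonneg) auto
  finally show ?thesis .
qed

text \<open>The excess \<open>v\<close> of \<open>w\<close> over
  \<open>a *\<^sub>R T (x + y)\<close> is at most \<open>K *\<^sub>R q\<close> at every grid point.
  Taking \<open>q = p (Suc j) + n j\<close>, which dominates both error terms, makes
  \<open>disjoint_chain_eq_zero\<close> applicable.\<close>

lemma le_by_grid:
  assumes "0 \<le> x" "0 \<le> y" "1 \<le> N" "w \<le> T (x + y)" "0 \<le> K"
    and grid: "\<And>j q. \<lbrakk>j \<le> N; T (sup (x - (real (Suc j) / real N) *\<^sub>R (x + y)) 0) \<le> q;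
       T (sup ((real j / real N) *\<^sub>R (x + y) - x) 0) \<le> q\<rbrakk>
       \<Longrightarrow> w \<le> a *\<^sub>R T (x + y) + K *\<^sub>R q"
    and "0 \<le> a"
  shows "w \<le> a *\<^sub>R T (x + y)"
proof -
  define e where "e = x + y"
  define p where "p j = T (sup (x - (real j / real N) *\<^sub>R e) 0)" for j :: nat
  define n where "n j = T (sup ((real j / real N) *\<^sub>R e - x) 0)" for j :: nat
  have e0: "0 \<le> e" "x \<le> e" using assms by (auto simp: e_def)
  have u0: "0 \<le> T e" using e0 T_nonneg by blast
  have p0: "0 \<le> p j" and n0: "0 \<le> n j" for j
    by (auto simp: p_def n_def intro: T_nonneg)
  define v where "v = sup (w - a *\<^sub>R T e) 0"
  have "v = 0"
  proof (rule disjoint_chain_eq_zero[of p n v K "real N" N])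
    show "inf (n j) (p j) = 0" for j
      using inf_pos_neg_part[of "(real j / real N) *\<^sub>R e - x"]
      by (simp add: n_def p_def T_zero flip: T_inf)
    show "n 0 = 0" using assms(1) by (simp add: n_def T_zero sup_absorb2)
    show "v \<le> K *\<^sub>R (p (Suc j) + n j)" if "j \<le> N" for j
    proof -
      have "w \<le> a *\<^sub>R T e + K *\<^sub>R (p (Suc j) + n j)"
        unfolding e_def
      proof (rule grid[OF that])
        show "T (sup (x - (real (Suc j) / real N) *\<^sub>R (x + y)) 0) \<le> p (Suc j) + n j"
          using n0[of j] unfolding p_def e_def by simp
        show "T (sup ((real j / real N) *\<^sub>R (x + y) - x) 0) \<le> p (Suc j) + n j"
          using p0[of "Suc j"] unfolding n_def e_def by simp
      qed
      then show ?thesis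
        unfolding v_def using assms(5) p0 n0
        by (auto intro!: sup_least scaleR_nonneg_nonneg add_nonneg_nonneg simp: algebra_simps)
    qed
    \<comment> \<open>The chain ends one step past \<open>c = 1\<close>: there
      \<open>c *\<^sub>R e - x\<close> is at least \<open>(1 / real N) *\<^sub>R e\<close>, because
      \<open>x \<le> e\<close>.\<close>
    show "v \<le> real N *\<^sub>R n (Suc N)"
    proof -
      have "w - a *\<^sub>R T e \<le> T e"
        using assms(4,7) u0 by (simp add: diff_le_eq e_def add_increasing2 scaleR_nonneg_nonneg)
      then have "v \<le> T e" using u0 by (simp add: v_def)
      also have "T e = real N *\<^sub>R T ((1 / real N) *\<^sub>R e)"
        using assms(3) by (simp add: scale)
      also have "\<dots> \<le> real N *\<^sub>R n (Suc N)"
      proof (intro scaleR_left_mono)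
        have "(real (Suc N) / real N) *\<^sub>R e = e + (1 / real N) *\<^sub>R e"
          using assms(3) by (simp add: add_divide_distrib scaleR_add_left)
        then have "(1 / real N) *\<^sub>R e \<le> (real (Suc N) / real N) *\<^sub>R e - x"
          using e0 by (simp add: algebra_simps)
        then show "T ((1 / real N) *\<^sub>R e) \<le> n (Suc N)"
          unfolding n_def by (intro T_mono le_supI1)
      qed simp
      finally show ?thesis .
    qed
    show "0 \<le> v" by (simp add: v_def)
  qed (use assms p0 n0 in auto)
  then have "w - a *\<^sub>R T e \<le> 0" by (metis v_def sup_ge1)
  then show ?thesis by (simp add: e_def)
qed

text \<open>In the sum of the bounds for \<open>T x\<close> and \<open>T y\<close> the grid value
  \<open>c\<close> cancels, leaving \<open>1 + 3 * d\<close> from above and \<open>1 - 3 * d\<close>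
  from below.\<close>

lemma T_add_approx:
  assumes "0 \<le> x" "0 \<le> y" "1 \<le> N"
  shows "T x + T y - T (x + y) \<le> (3 / real N) *\<^sub>R T (x + y)" (is ?A)
    and "T (x + y) - T x - T y \<le> (3 / real N) *\<^sub>R T (x + y)" (is ?B)
proof -
  define e where "e = x + y"
  define d where "d = 1 / real N"
  \<comment> \<open>The largest coefficient to be covered is \<open>(c + 2 * d) / d = j + 2\<close>,
    with \<open>j \<le> N\<close>.\<close>
  define K where "K = real N + 2"
  have d: "0 < d" "real N * d = 1" "1 / d = real N" using assms by (auto simp: d_def)
  have e: "0 \<le> e" "x \<le> e" "y \<le> e" using assms by (auto simp: e_def)
  have Te: "T x \<le> T e" "T y \<le> T e" "0 \<le> T x" "0 \<le> T y"
    using e assms by (auto intro: T_mono T_nonneg)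
  have bounds: "T x \<le> (c + 2 * d) *\<^sub>R T e + K *\<^sub>R q" "T y \<le> (1 - c + d) *\<^sub>R T e + K *\<^sub>R q"
    "(c - d) *\<^sub>R T e \<le> T x + K *\<^sub>R q" "(1 - c - 2 * d) *\<^sub>R T e \<le> T y + K *\<^sub>R q"
    if j: "j \<le> N" and c: "c = real j / real N"
      and p: "T (sup (x - (real (Suc j) / real N) *\<^sub>R (x + y)) 0) \<le> q"
      and n: "T (sup ((real j / real N) *\<^sub>R (x + y) - x) 0) \<le> q" for j c q
  proof -
    have c': "0 \<le> c" "c \<le> 1" "c / d = real j" "real (Suc j) / real N = c + d"
      using j assms(3) by (auto simp: c d_def add_divide_distrib)
    have p: "T (sup (x - (c + d) *\<^sub>R e) 0) \<le> q" and n: "T (sup (c *\<^sub>R e - x) 0) \<le> q"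
      using p n c' unfolding e_def c by auto
    \<comment> \<open>Since \<open>e = x + y\<close>, an excess of \<open>y\<close> is a deficit of
      \<open>x\<close> and conversely, so the same two error terms control \<open>y\<close>.\<close>
    have y1: "y - (1 - c) *\<^sub>R e = c *\<^sub>R e - x" "(1 - c - d) *\<^sub>R e - y = x - (c + d) *\<^sub>R e"
      by (auto simp: e_def algebra_simps)
    have k: "(c + d + d) / d \<le> K" "(1 - c + d) / d \<le> K"
      using j d c' by (auto simp: add_divide_distrib diff_divide_distrib K_def)
    show "T x \<le> (c + 2 * d) *\<^sub>R T e + K *\<^sub>R q"
      by (rule T_upper_grid[OF _ _ _ k(1) p]) (use e c' d in auto)
    show "T y \<le> (1 - c + d) *\<^sub>R T e + K *\<^sub>R q"
      by (rule T_upper_grid[OF _ _ _ k(2)]) (use e c' d n y1 in auto)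
    show "(c - d) *\<^sub>R T e \<le> T x + K *\<^sub>R q"
      by (rule T_lower_grid[OF _ _ d(1) _ n]) (use e c' d assms in \<open>auto simp: K_def\<close>)
    show "(1 - c - 2 * d) *\<^sub>R T e \<le> T y + K *\<^sub>R q"
      by (rule T_lower_grid[where c = "1 - c - d" and d = d])
        (use e c' d p y1 assms in \<open>auto simp: K_def\<close>)
  qed
  have collect: "(r *\<^sub>R T e + K *\<^sub>R q) + (s *\<^sub>R T e + K *\<^sub>R q) = (r + s) *\<^sub>R T e + (2 * K) *\<^sub>R q"
    for r s q
    unfolding mult_2 scaleR_add_left by (simp add: ac_simps)
  show ?A
  proof (rule le_by_grid[where K = "2 * K" and N = N])
    show "T x + T y - T (x + y) \<le> T (x + y)"
      using Te by (simp add: e_def diff_le_eq add_mono)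
    fix j q
    assume "j \<le> N" "T (sup (x - (real (Suc j) / real N) *\<^sub>R (x + y)) 0) \<le> q"
      "T (sup ((real j / real N) *\<^sub>R (x + y) - x) 0) \<le> q"
    note b = bounds[OF this(1) refl this(2,3)]
    have "T x + T y \<le> (1 + 3 * d) *\<^sub>R T e + (2 * K) *\<^sub>R q"
      using add_mono[OF b(1,2)] by (simp only: collect) (simp add: add.commute)
    then show "T x + T y - T (x + y) \<le> (3 / real N) *\<^sub>R T (x + y) + (2 * K) *\<^sub>R q"
      by (simp add: e_def d_def algebra_simps)
  qed (use assms in \<open>auto simp: K_def\<close>)
  show ?B
  proof (rule le_by_grid[where K = "2 * K" and N = N])
    show "T (x + y) - T x - T y \<le> T (x + y)"
      using Te by (simp add: e_def diff_le_eq add_increasing2)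
    fix j q
    assume "j \<le> N" "T (sup (x - (real (Suc j) / real N) *\<^sub>R (x + y)) 0) \<le> q"
      "T (sup ((real j / real N) *\<^sub>R (x + y) - x) 0) \<le> q"
    note b = bounds[OF this(1) refl this(2,3)]
    have "(1 - 3 * d) *\<^sub>R T e \<le> T x + T y + (2 * K) *\<^sub>R q"
    proof -
      have "(1 - 3 * d) *\<^sub>R T e = (real j / real N - d) *\<^sub>R T e + (1 - real j / real N - 2 * d) *\<^sub>R T e"
        by (simp flip: scaleR_add_left)
      also have "\<dots> \<le> (T x + K *\<^sub>R q) + (T y + K *\<^sub>R q)"
        by (intro add_mono b)
      also have "\<dots> = T x + T y + (2 * K) *\<^sub>R q"
        unfolding mult_2 scaleR_add_left by (simp add: ac_simps)
      finally show ?thesis .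
    qed
    then show "T (x + y) - T x - T y \<le> (3 / real N) *\<^sub>R T (x + y) + (2 * K) *\<^sub>R q"
      by (simp add: e_def d_def algebra_simps)
  qed (use assms in \<open>auto simp: K_def\<close>)
qed

end

section \<open>Passage to the limit and extension from the positive cone\<close>

theorem theorem6:
  fixes T :: "'a::archimedean_riesz_space \<Rightarrow> 'b::archimedean_riesz_space"
  assumes "lattice_homomorphism T"
    and "\<And>(c::real) x. T (c *\<^sub>R x) = c *\<^sub>R T x"
  shows "riesz_homomorphism T"
proof -
  note parts = eq_pos_part_diff_neg_part
  interpret homogeneous_lattice_homomorphism T
    using assms by unfold_locales
  have add_nonneg: "T (x + y) = T x + T y" if xy: "0 \<le> x" "0 \<le> y" for x y
  proof (rule antisym)
    \<comment> \<open>The constant 3 is absorbed into the element to which the Archimedean axiom is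
      applied.\<close>
    have u: "0 \<le> 3 *\<^sub>R T (x + y)"
      using xy by (intro scaleR_nonneg_nonneg T_nonneg) auto
    have "T x + T y - T (x + y) \<le> 0"
      by (rule archimedean[OF u]) (use T_add_approx(1)[OF xy] in simp)
    then show "T x + T y \<le> T (x + y)" by simp
    have "T (x + y) - T x - T y \<le> 0"
      by (rule archimedean[OF u]) (use T_add_approx(2)[OF xy] in simp)
    then show "T (x + y) \<le> T x + T y" by (simp add: algebra_simps)
  qed
  \<comment> \<open>For \<open>z = a - b\<close>, moving the subtracted terms across gives an
    equation between sums of nonnegative elements. \<open>T\<close> preserves positive and negative
    parts, which yields \<open>T z\<close>.\<close>
  have diff_nonneg: "T (a - b) = T a - T b" if ab: "0 \<le> a" "0 \<le> b" for a b
  proof -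
    define z where "z = a - b"
    have "p + b = n + a" if "z = p - n" for p n
      using that by (simp add: z_def algebra_simps)
    then have "sup z 0 + b = sup (- z) 0 + a"
      using parts by blast
    then have "T (sup z 0) + T b = T (sup (- z) 0) + T a"
      using ab by (metis add_nonneg sup_ge2)
    moreover have "T z = T (sup z 0) - T (sup (- z) 0)"
      using parts[of "T z"] by (simp add: T_sup T_minus T_zero)
    moreover have "r = T a - T b" if "p + T b = n + T a" "r = p - n" for p n r
    proof -
      have "r + (n + T b) = p + T b" using that(2) by (simp add: algebra_simps)
      then show ?thesis using that(1) by (simp add: algebra_simps)
    qed
    ultimately have "T z = T a - T b" by blast
    then show ?thesis by (simp add: z_def)
  qed
  have "T (x + y) = T x + T y" for x y
  proof -
    have "x + y = (sup x 0 - sup (- x) 0) + (sup y 0 - sup (- y) 0)"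
      using arg_cong2[of _ _ _ _ "(+)", OF parts parts] .
    also have "\<dots> = (sup x 0 + sup y 0) - (sup (- x) 0 + sup (- y) 0)"
      by (rule add_diff_add[symmetric])
    finally have "x + y = \<dots>" .
    then have "T (x + y) = T (sup x 0) + T (sup y 0) - (T (sup (- x) 0) + T (sup (- y) 0))"
      by (simp add: diff_nonneg add_nonneg)
    also have "\<dots> = T (sup x 0 - sup (- x) 0) + T (sup y 0 - sup (- y) 0)"
      by (simp only: diff_nonneg[OF sup_ge2 sup_ge2] add_diff_add)
    finally show ?thesis unfolding parts[symmetric] .
  qed
  with assms show ?thesis
    by (simp add: riesz_homomorphism_def linear_iff)
qed

end
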